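(* Let $D\subset\mathbb{R}^2$ be an open set (the domain of $\mathbf q=(q_1,q_2)$), and consider a system with generalized coordinates $(q_1,q_2,q_3)$, with the nonholonomic constraint $\dot q_3=a_1(\mathbf q)\dot q_1+a_2(\mathbf q)\dot q_2$ and the Lagrangian $$L=\frac12\sum_{i,j=1}^{3}g_{ij}(\mathbf q)\dot q_i\dot q_j+\sum_{i=1}^{3}c_i(\mathbf q)\dot q_i-U(\mathbf q),$$ where $g_{ij},c_i,U,a_1,a_2$ are smooth functions on $D$, the matrix $\|g_{ij}(\mathbf q)\|$ is symmetric, $\frac{\partial a_1}{\partial q_2}\neq\frac{\partial a_2}{\partial q_1}$, and the constrained Lagrangian $L^*$ admits a Legendre transform (its quadratic form in $(\dot q_1,\dot q_2)$ is nondegenerate at each $\mathbf q\in D$). Suppose that the reduced system of equations for $(\mathbf q,\mathbf P)\in D\times\mathbb{R}^2$ (written out in the context) admits an invariant measure $\mathcal N(\mathbf q)\,d\mathbf q\,d\mathbf P$ with smooth positive density $\mathcal N(\mathbf q)$ depending only on $\mathbf q$. Then the reduced equations of motion can be represented, on the entire phase space $D\times\mathbb{R}^2$, in conformally Hamiltonian form.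
   Context: Reduced system. Let $L^*(\mathbf q,\dot q_1,\dot q_2)$ be the Lagrangian $L$ after substituting $\dot q_3=a_1\dot q_1+a_2\dot q_2$, and let $$S=\left(\frac{\partial L}{\partial\dot q_3}\right)^{*}\left(\frac{\partial a_1}{\partial q_2}-\frac{\partial a_2}{\partial q_1}\right),$$ where $(\cdot)^*$ means that $\dot q_3=a_1\dot q_1+a_2\dot q_2$ is substituted after differentiation. The constrained Euler--Lagrange equations reduce to $\frac{d}{dt}\frac{\partial L^*}{\partial\dot q_1}-\frac{\partial L^*}{\partial q_1}=S\dot q_2$, $\frac{d}{dt}\frac{\partial L^*}{\partial\dot q_2}-\frac{\partial L^*}{\partial q_2}=-S\dot q_1$. Put $P_i=\partial L^*/\partial\dot q_i$ and $H(\mathbf q,\mathbf P)=P_1\dot q_1+P_2\dot q_2-L^*$ (with $\dot q_i$ and $S$ expressed through $\mathbf q,\mathbf P$). The reduced system is $$\dot q_i=\frac{\partial H}{\partial P_i},\quad \dot P_1=-\frac{\partial H}{\partial q_1}+\frac{\partial H}{\partial P_2}S,\quad \dot P_2=-\frac{\partial H}{\partial q_2}-\frac{\partial H}{\partial P_1}S .$$ Invariant measure: $\mathcal N\,d\mathbf q\,d\mathbf P$ is invariant if $\operatorname{div}(\mathcal N\mathbf v)=0$, where $\mathbf v$ is the vector field of the reduced system and the divergence is taken in the coordinates $(\mathbf q,\mathbf P)$. Conformally Hamiltonian form: the equations become Hamiltonian after a rescaling of time; that is, there are a Poisson bracket $\{\cdot,\cdot\}$ on the phase space, a smooth function $\overline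 H$ (Hamiltonian) and a smooth positive function $\rho(\mathbf q)$ of the configuration variables such that, in suitable coordinates $x$ on the phase space, the equations of motion read $\dot x_k=\rho\,\{x_k,\overline H\}$. *)

theory Defs
  imports "HOL-Analysis.Analysis"
begin

section \<open>Smooth functions and partial derivatives\<close>

text \<open>Meant for open sets \<open>S\<close> only: the derivatives are taken at the points of \<open>S\<close> in the
  ambient space.\<close>

primrec Ck_on :: "nat \<Rightarrow> 'a::real_normed_vector set \<Rightarrow> ('a \<Rightarrow> 'b::real_normed_vector) \<Rightarrow> bool" where
  "Ck_on 0 S f \<longleftrightarrow> continuous_on S f"
| "Ck_on (Suc n) S f \<longleftrightarrow> (\<forall>x\<in>S. f differentiable (at x)) \<and>
     (\<forall>v. Ck_on n S (\<lambda>x. frechet_derivative f (at x) v))"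

definition smooth_on :: "'a::real_normed_vector set \<Rightarrow> ('a \<Rightarrow> 'b::real_normed_vector) \<Rightarrow> bool" where
  "smooth_on S f \<longleftrightarrow> (\<forall>n. Ck_on n S f)"

text \<open>Derivative of \<open>f\<close> at \<open>x\<close> in the direction \<open>v\<close>; for a coordinate vector \<open>v\<close> this is the
  partial derivative.\<close>

definition dir_deriv :: "('a::real_vector \<Rightarrow> real) \<Rightarrow> 'a \<Rightarrow> 'a \<Rightarrow> real" where
  "dir_deriv f x v = deriv (\<lambda>t. f (x + t *\<^sub>R v)) 0"

definition divergence :: "('a::euclidean_space \<Rightarrow> 'a) \<Rightarrow> 'a \<Rightarrow> real" where
  "divergence X z = (\<Sum>b\<in>Basis. dir_deriv (\<lambda>y. X y \<bullet> b) z b)"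

section \<open>The constrained Lagrangian system and its reduction\<close>

type_synonym phase = "(real^2) \<times> (real^2)"

definition lagrangian ::
  "(real^2 \<Rightarrow> real^3^3) \<Rightarrow> (real^2 \<Rightarrow> real^3) \<Rightarrow> (real^2 \<Rightarrow> real) \<Rightarrow> real^2 \<Rightarrow> real^3 \<Rightarrow> real" where
  "lagrangian g c U q w =
     (1/2) * (\<Sum>i\<in>UNIV. \<Sum>j\<in>UNIV. g q $ i $ j * w $ i * w $ j) + (\<Sum>i\<in>UNIV. c q $ i * w $ i) - U q"

definition constrained_velocity ::
  "(real^2 \<Rightarrow> real) \<Rightarrow> (real^2 \<Rightarrow> real) \<Rightarrow> real^2 \<Rightarrow> real^2 \<Rightarrow> real^3" where
  "constrained_velocity a1 a2 q u = vector [u $ 1, u $ 2, a1 q * u $ 1 + a2 q * u $ 2]"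

definition constrained_lagrangian ::
  "(real^2 \<Rightarrow> real) \<Rightarrow> (real^2 \<Rightarrow> real) \<Rightarrow> (real^2 \<Rightarrow> real^3 \<Rightarrow> real) \<Rightarrow> real^2 \<Rightarrow> real^2 \<Rightarrow> real" where
  "constrained_lagrangian a1 a2 L q u = L q (constrained_velocity a1 a2 q u)"

text \<open>The polar form of the quadratic part of \<open>L\<^sup>*\<close> (twice the kinetic energy on the constraint plane).\<close>

definition constrained_form ::
  "(real^2 \<Rightarrow> real) \<Rightarrow> (real^2 \<Rightarrow> real) \<Rightarrow> (real^2 \<Rightarrow> real^3^3) \<Rightarrow> real^2 \<Rightarrow> real^2 \<Rightarrow> real^2 \<Rightarrow> real" where
  "constrained_form a1 a2 g q u u' =
     (\<Sum>i\<in>UNIV. \<Sum>j\<in>UNIV. g q $ i $ j * constrained_velocity a1 a2 q u $ i * constrained_velocity a1 a2 q u' $ j)"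

definition nondegenerate_form :: "('a::real_vector \<Rightarrow> 'a \<Rightarrow> real) \<Rightarrow> bool" where
  "nondegenerate_form b \<longleftrightarrow> (\<forall>u. (\<forall>u'. b u u' = 0) \<longrightarrow> u = 0)"

definition legendre_momentum :: "(real^2 \<Rightarrow> real^2 \<Rightarrow> real) \<Rightarrow> real^2 \<Rightarrow> real^2 \<Rightarrow> real^2" where
  "legendre_momentum Ls q u = (\<chi> i. dir_deriv (Ls q) u (axis i 1))"

text \<open>The velocities expressed through \<open>q, P\<close>; see \<open>legendre_momentum_ex1\<close> below.\<close>

definition legendre_velocity :: "(real^2 \<Rightarrow> real^2 \<Rightarrow> real) \<Rightarrow> phase \<Rightarrow> real^2" where
  "legendre_velocity Ls z = (THE u. legendre_momentum Ls (fst z) u = snd z)"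

definition reduced_hamiltonian :: "(real^2 \<Rightarrow> real^2 \<Rightarrow> real) \<Rightarrow> phase \<Rightarrow> real" where
  "reduced_hamiltonian Ls z =
     (\<Sum>i\<in>UNIV. snd z $ i * legendre_velocity Ls z $ i) - Ls (fst z) (legendre_velocity Ls z)"

definition curvature_term ::
  "(real^2 \<Rightarrow> real) \<Rightarrow> (real^2 \<Rightarrow> real) \<Rightarrow> (real^2 \<Rightarrow> real^3 \<Rightarrow> real) \<Rightarrow> real^2 \<Rightarrow> real^2 \<Rightarrow> real" where
  "curvature_term a1 a2 L q u =
     dir_deriv (L q) (constrained_velocity a1 a2 q u) (axis 3 1) *
     (dir_deriv a1 q (axis 2 1) - dir_deriv a2 q (axis 1 1))"

definition reduced_field ::
  "(real^2 \<Rightarrow> real) \<Rightarrow> (real^2 \<Rightarrow> real) \<Rightarrow> (real^2 \<Rightarrow> real^3 \<Rightarrow> real) \<Rightarrow> phase \<Rightarrow> phase" where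
  "reduced_field a1 a2 L z =
     (let Ls = constrained_lagrangian a1 a2 L;
          H = reduced_hamiltonian Ls;
          S = curvature_term a1 a2 L (fst z) (legendre_velocity Ls z);
          Hq = (\<lambda>i. dir_deriv H z (axis i 1, 0));
          HP = (\<lambda>i. dir_deriv H z (0, axis i 1))
      in (vector [HP 1, HP 2], vector [- Hq 1 + HP 2 * S, - Hq 2 - HP 1 * S]))"

definition invariant_measure_density_on :: "phase set \<Rightarrow> (phase \<Rightarrow> phase) \<Rightarrow> (phase \<Rightarrow> real) \<Rightarrow> bool" where
  "invariant_measure_density_on M v N \<longleftrightarrow> (\<forall>z\<in>M. divergence (\<lambda>y. N y *\<^sub>R v y) z = 0)"

section \<open>Conformally Hamiltonian form\<close>

text \<open>A Poisson bracket on the algebra of smooth functions on the open set \<open>M\<close>. The second clause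
  says that the bracket only depends on the restrictions of its arguments to \<open>M\<close>. The bracket may
  be degenerate.\<close>

definition poisson_bracket_on ::
  "'a::real_normed_vector set \<Rightarrow> (('a \<Rightarrow> real) \<Rightarrow> ('a \<Rightarrow> real) \<Rightarrow> ('a \<Rightarrow> real)) \<Rightarrow> bool" where
  "poisson_bracket_on M B \<longleftrightarrow>
     (\<forall>f g. smooth_on M f \<and> smooth_on M g \<longrightarrow> smooth_on M (B f g)) \<and>
     (\<forall>f f' g. smooth_on M f \<and> smooth_on M f' \<and> smooth_on M g \<and> (\<forall>z\<in>M. f z = f' z) \<longrightarrow>
        (\<forall>z\<in>M. B f g z = B f' g z)) \<and>
     (\<forall>f g. smooth_on M f \<and> smooth_on M g \<longrightarrow> (\<forall>z\<in>M. B g f z = - B f g z)) \<and>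
     (\<forall>f g h \<alpha> \<beta>. smooth_on M f \<and> smooth_on M g \<and> smooth_on M h \<longrightarrow>
        (\<forall>z\<in>M. B (\<lambda>y. \<alpha> * f y + \<beta> * g y) h z = \<alpha> * B f h z + \<beta> * B g h z)) \<and>
     (\<forall>f g h. smooth_on M f \<and> smooth_on M g \<and> smooth_on M h \<longrightarrow>
        (\<forall>z\<in>M. B (\<lambda>y. f y * g y) h z = f z * B g h z + g z * B f h z)) \<and>
     (\<forall>f g h. smooth_on M f \<and> smooth_on M g \<and> smooth_on M h \<longrightarrow>
        (\<forall>z\<in>M. B f (B g h) z + B g (B h f) z + B h (B f g) z = 0))"

text \<open>Coordinates defined on the whole open set \<open>M\<close>: a diffeomorphism of \<open>M\<close> onto an open set.\<close>

definition global_coordinates_on ::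
  "'a::real_normed_vector set \<Rightarrow> ('a \<Rightarrow> 'b::real_normed_vector) \<Rightarrow> bool" where
  "global_coordinates_on M x \<longleftrightarrow>
     smooth_on M x \<and> inj_on x M \<and> open (x ` M) \<and> smooth_on (x ` M) (inv_into M x)"

text \<open>The left-hand side of the last equation is the time derivative of the coordinate \<open>x\<^sub>k\<close> along the
  solutions of \<open>dz/dt = v z\<close>.\<close>

definition conformally_hamiltonian_on :: "(real^2) set \<Rightarrow> (phase \<Rightarrow> phase) \<Rightarrow> bool" where
  "conformally_hamiltonian_on D v \<longleftrightarrow>
     (\<exists>B (Hbar :: phase \<Rightarrow> real) (\<rho> :: real^2 \<Rightarrow> real) (x :: phase \<Rightarrow> real^4).
        poisson_bracket_on (D \<times> UNIV) B \<and>
        smooth_on (D \<times> UNIV) Hbar \<and>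
        smooth_on D \<rho> \<and> (\<forall>q\<in>D. \<rho> q > 0) \<and>
        global_coordinates_on (D \<times> UNIV) x \<and>
        (\<forall>q\<in>D. \<forall>P k. dir_deriv (\<lambda>z. x z $ k) (q, P) (v (q, P)) = \<rho> q * B (\<lambda>z. x z $ k) Hbar (q, P)))"

section \<open>The Legendre transform is well defined\<close>

lemma constrained_velocity_linear: "linear (constrained_velocity a1 a2 q)"
  by (rule linearI) (simp_all add: constrained_velocity_def vec_eq_iff forall_3 algebra_simps)

lemma legendre_momentum_lagrangian:
  assumes "transpose (g q) = g q"
  shows "legendre_momentum (constrained_lagrangian a1 a2 (lagrangian g c U)) q u $ i =
    constrained_form a1 a2 g q u (axis i 1) + (\<Sum>j\<in>UNIV. c q $ j * constrained_velocity a1 a2 q (axis i 1) $ j)"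
proof -
  define w where "w = constrained_velocity a1 a2 q u"
  define e where "e = constrained_velocity a1 a2 q (axis i 1)"
  have g: "g q $ j $ k = g q $ k $ j" for j k
    using arg_cong[OF assms, of "\<lambda>A. A $ k $ j"] by (simp add: transpose_def)
  have lin: "constrained_velocity a1 a2 q (u + t *\<^sub>R axis i 1) = w + t *\<^sub>R e" for t
    unfolding w_def e_def
    by (simp add: linear_add[OF constrained_velocity_linear] linear_cmul[OF constrained_velocity_linear])
  have "((\<lambda>t. lagrangian g c U q (w + t *\<^sub>R e)) has_field_derivative
      (\<Sum>j\<in>UNIV. \<Sum>k\<in>UNIV. g q $ j $ k * w $ j * e $ k) + (\<Sum>j\<in>UNIV. c q $ j * e $ j)) (at 0)"
    unfolding lagrangian_def sum_3 vector_add_component vector_scaleR_component real_scaleR_def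
    by (rule derivative_eq_intros refl)+ (simp add: g[of 2 1] g[of 3 1] g[of 3 2] algebra_simps)
  then show ?thesis
    unfolding legendre_momentum_def dir_deriv_def constrained_lagrangian_def constrained_form_def
    by (simp add: lin DERIV_imp_deriv flip: w_def e_def)
qed

lemma legendre_momentum_ex1:
  assumes sym: "transpose (g q) = g q"
    and nondeg: "nondegenerate_form (constrained_form a1 a2 g q)"
  shows "\<exists>!u. legendre_momentum (constrained_lagrangian a1 a2 (lagrangian g c U)) q u = P"
proof -
  define F where "F u = (\<chi> i. constrained_form a1 a2 g q u (axis i 1))" for u :: "real^2"
  define k where "k = (\<chi> i. \<Sum>j\<in>UNIV. c q $ j * constrained_velocity a1 a2 q (axis i 1) $ j)"
  have F: "linear F"
    by (rule linearI) (simp_all add: F_def vec_eq_iff constrained_form_def sum_3 algebra_simps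
        linear_add[OF constrained_velocity_linear] linear_cmul[OF constrained_velocity_linear])
  have "u = 0" if "F u = 0" for u
  proof -
    have z: "constrained_form a1 a2 g q u (axis i 1) = 0" for i
      using that by (simp add: F_def vec_eq_iff)
    have "constrained_form a1 a2 g q u u' =
        u' $ 1 * constrained_form a1 a2 g q u (axis 1 1) + u' $ 2 * constrained_form a1 a2 g q u (axis 2 1)" for u'
      by (simp add: constrained_form_def constrained_velocity_def sum_3 axis_def algebra_simps)
    then show ?thesis
      using nondeg z by (simp add: nondegenerate_form_def)
  qed
  then have "inj F"
    using F by (simp add: linear_injective_0)
  then have "bij F"
    using F by (simp add: bij_def linear_injective_imp_surjective)
  then have "\<exists>!u. F u = P - k"
    by (metis bij_pointE)
  moreover have "legendre_momentum (constrained_lagrangian a1 a2 (lagrangian g c U)) q u = P \<longleftrightarrow> F u = P - k" for u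
    by (simp add: vec_eq_iff legendre_momentum_lagrangian[of g q, OF sym] F_def k_def eq_diff_eq)
  ultimately show ?thesis by simp
qed

end

theory Submission
  imports Defs
begin

text \<open>The term \<open>S\<close> is affine in the momenta, and \<open>\<partial>H/\<partial>P\<close> is the velocity, which takes arbitrary values
  over each \<open>q\<close>. Since the canonical part of the field is divergence free, invariance of \<open>N dq dP\<close>
  therefore says exactly that \<open>N \<partial>S/\<partial>P\<^sub>1 = -\<partial>N/\<partial>q\<^sub>2\<close> and \<open>N \<partial>S/\<partial>P\<^sub>2 = \<partial>N/\<partial>q\<^sub>1\<close>. The reduced field is
  \<open>N {\<cdot>, H}\<close> for the bracket \<open>{q\<^sub>i, P\<^sub>j} = \<delta>\<^sub>i\<^sub>j / N\<close>, \<open>{P\<^sub>1, P\<^sub>2} = S / N\<close>, and these two equations are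
  exactly its Jacobi identity (in the coordinates \<open>q, p = N P\<close> it is the canonical bracket with a
  magnetic term \<open>{p\<^sub>1, p\<^sub>2}\<close> depending on \<open>q\<close> only). Hence \<open>\<rho> = N\<close> and the Hamiltonian is \<open>H\<close> itself.\<close>

section \<open>Calculus of smooth functions\<close>

declare Ck_on.simps[simp del]

section \<open>Directional derivatives as Frechet derivatives\<close>

lemma dir_deriv_frechet:
  assumes "f differentiable (at z)"
  shows "dir_deriv f z v = frechet_derivative f (at z) v"
    and "((\<lambda>t. f (z + t *\<^sub>R v)) has_real_derivative dir_deriv f z v) (at 0)"
proof -
  let ?f' = "frechet_derivative f (at z)"
  have f': "(f has_derivative ?f') (at z)"
    using assms by (simp add: frechet_derivative_works)
  have "((\<lambda>t. z + t *\<^sub>R v) has_derivative (\<lambda>t. t *\<^sub>R v)) (at 0)"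
    by (auto intro!: derivative_eq_intros)
  then have "((\<lambda>t. f (z + t *\<^sub>R v)) has_derivative (\<lambda>t. ?f' (t *\<^sub>R v))) (at 0)"
    by (rule has_derivative_compose) (use f' in simp)
  moreover have "?f' (t *\<^sub>R v) = ?f' v * t" for t
    using linear_frechet_derivative[OF assms] by (simp add: linear_cmul)
  ultimately have *: "((\<lambda>t. f (z + t *\<^sub>R v)) has_real_derivative ?f' v) (at 0)"
    by (simp add: has_field_derivative_def)
  then show "dir_deriv f z v = ?f' v"
    by (simp add: dir_deriv_def DERIV_imp_deriv)
  with * show "((\<lambda>t. f (z + t *\<^sub>R v)) has_real_derivative dir_deriv f z v) (at 0)"
    by simp
qed

lemma dir_deriv_cong_open:
  fixes f g :: "'a::real_normed_vector \<Rightarrow> real"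
  assumes "open S" "z \<in> S" "\<And>y. y \<in> S \<Longrightarrow> f y = g y"
  shows "dir_deriv f z v = dir_deriv g z v"
  unfolding dir_deriv_def
proof (rule deriv_cong_ev)
  have "isCont (\<lambda>t. z + t *\<^sub>R v) 0"
    by (intro continuous_intros)
  then have "((\<lambda>t. z + t *\<^sub>R v) \<longlongrightarrow> z + 0 *\<^sub>R v) (nhds 0)"
    using tendsto_at_iff_tendsto_nhds[of "\<lambda>t. z + t *\<^sub>R v" 0] by (simp add: isCont_def)
  then have "\<forall>\<^sub>F t in nhds 0. z + t *\<^sub>R v \<in> S"
    using assms(1,2) by (auto simp: tendsto_def)
  then show "\<forall>\<^sub>F t in nhds 0. f (z + t *\<^sub>R v) = g (z + t *\<^sub>R v)"
    by eventually_elim (simp add: assms)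
qed simp

section \<open>Closure properties of the classes \<open>Ck_on\<close>\<close>

lemma Ck_on_cong:
  assumes "open S" "\<And>x. x \<in> S \<Longrightarrow> f x = g x" "Ck_on n S f"
  shows "Ck_on n S g"
  using assms(2,3)
proof (induction n arbitrary: f g)
  case 0
  then show ?case
    by (metis Ck_on.simps(1) continuous_on_cong)
next
  case (Suc n)
  have d: "g differentiable (at x)" "frechet_derivative g (at x) = frechet_derivative f (at x)" if "x \<in> S" for x
  proof -
    have "(f has_derivative frechet_derivative f (at x)) (at x)"
      using Suc.prems(2) that by (simp add: Ck_on.simps frechet_derivative_works)
    then have *: "(g has_derivative frechet_derivative f (at x)) (at x)"
      using has_derivative_transform_within_open[OF _ assms(1) that] Suc.prems(1) by blast
    then show "g differentiable (at x)"
      by (rule differentiableI)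
    show "frechet_derivative g (at x) = frechet_derivative f (at x)"
      using frechet_derivative_at[OF *] by simp
  qed
  have "Ck_on n S (\<lambda>x. frechet_derivative g (at x) v)" for v
    by (rule Suc.IH[of "\<lambda>x. frechet_derivative f (at x) v"]) (use d Suc.prems(2) in \<open>simp_all add: Ck_on.simps\<close>)
  then show ?case
    using d by (simp add: Ck_on.simps)
qed

text \<open>Lets an induction step use whatever derivative the differentiation rules produce:
  derivatives are unique, so on the open set it agrees with the \<open>frechet_derivative\<close> in
  the definition of \<open>Ck_on\<close>.\<close>

lemma Ck_on_SucI:
  assumes "open S" "\<And>x. x \<in> S \<Longrightarrow> (f has_derivative f' x) (at x)" "\<And>v. Ck_on n S (\<lambda>x. f' x v)"
  shows "Ck_on (Suc n) S f"
proof -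
  have "Ck_on n S (\<lambda>x. frechet_derivative f (at x) v)" for v
    by (rule Ck_on_cong[OF assms(1) _ assms(3)]) (simp flip: frechet_derivative_at[OF assms(2)])
  then show ?thesis
    using assms(2) by (auto simp: Ck_on.simps intro: differentiableI)
qed

text \<open>The derivatives of products and inverses contain undifferentiated factors, which have to
  be lowered to the order of the induction hypothesis.\<close>

lemma Ck_on_SucD:
  assumes "Ck_on (Suc n) S f"
  shows "Ck_on n S f"
  using assms
proof (induction n arbitrary: f)
  case 0
  then show ?case
    unfolding Ck_on.simps
    by (blast intro: continuous_at_imp_continuous_on differentiable_imp_continuous_within)
next
  case (Suc n)
  have "f differentiable (at x)" if "x \<in> S" for x
    using Suc.prems that by (simp add: Ck_on.simps)
  moreover have "Ck_on (Suc n) S (\<lambda>x. frechet_derivative f (at x) v)" for v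
    using Suc.prems unfolding Ck_on.simps(2)[of "Suc n" S f] by blast
  ultimately show ?case
    using Suc.IH unfolding Ck_on.simps(2)[of n S f] by blast
qed

lemma Ck_on_has_derivative:
  "Ck_on (Suc n) S f \<Longrightarrow> x \<in> S \<Longrightarrow> (f has_derivative frechet_derivative f (at x)) (at x)"
  by (simp add: Ck_on.simps frechet_derivative_works)

lemma Ck_on_frechet_derivative:
  "Ck_on (Suc n) S f \<Longrightarrow> Ck_on n S (\<lambda>x. frechet_derivative f (at x) v)"
  by (simp add: Ck_on.simps)

lemma Ck_on_const: "Ck_on n S (\<lambda>x. k)"
  by (induction n arbitrary: k) (auto simp: Ck_on.simps)

lemma Ck_on_add:
  assumes "open S" "Ck_on n S f" "Ck_on n S g"
  shows "Ck_on n S (\<lambda>x. f x + g x)"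
  using assms(2,3)
proof (induction n arbitrary: f g)
  case 0
  then show ?case by (simp add: Ck_on.simps continuous_intros)
next
  case (Suc n)
  show ?case
    by (rule Ck_on_SucI[OF assms(1) has_derivative_add])
      (auto intro!: Suc.IH Suc.prems[THEN Ck_on_has_derivative] Suc.prems[THEN Ck_on_frechet_derivative])
qed

lemma Ck_on_mult:
  fixes f g :: "_ \<Rightarrow> real"
  assumes "open S" "Ck_on n S f" "Ck_on n S g"
  shows "Ck_on n S (\<lambda>x. f x * g x)"
  using assms(2,3)
proof (induction n arbitrary: f g)
  case 0
  then show ?case by (simp add: Ck_on.simps continuous_intros)
next
  case (Suc n)
  show ?case
    by (rule Ck_on_SucI[OF assms(1) has_derivative_mult])
      (auto intro!: Ck_on_add[OF assms(1)] Suc.IH Suc.prems[THEN Ck_on_SucD]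
        Suc.prems[THEN Ck_on_has_derivative] Suc.prems[THEN Ck_on_frechet_derivative])
qed

text \<open>The derivative of \<open>1 / f\<close> is \<open>- (1 / f) f' (1 / f)\<close>, in which
  \<open>1 / f\<close> itself reappears. The induction can therefore keep \<open>f\<close> fixed,
  and the product rule does the rest.\<close>

lemma Ck_on_inverse:
  fixes f :: "_ \<Rightarrow> real"
  assumes "open S" "Ck_on n S f" "\<And>x. x \<in> S \<Longrightarrow> f x \<noteq> 0"
  shows "Ck_on n S (\<lambda>x. inverse (f x))"
  using assms(2)
proof (induction n)
  case 0
  then show ?case using assms(3) by (simp add: Ck_on.simps continuous_on_inverse)
next
  case (Suc n)
  let ?f' = "\<lambda>x. frechet_derivative f (at x)"
  have "Ck_on n S (\<lambda>x. (- 1) * (inverse (f x) * ?f' x v * inverse (f x)))" for v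
    by (intro Ck_on_mult[OF assms(1)] Ck_on_const Suc.IH Suc.prems[THEN Ck_on_SucD]
        Suc.prems[THEN Ck_on_frechet_derivative])
  then show ?case
    using Suc.prems assms(3)
    by (intro Ck_on_SucI[OF assms(1) Deriv.has_derivative_inverse])
      (auto intro!: Ck_on_has_derivative)
qed

lemma Ck_on_bounded_linear:
  assumes "open S" "bounded_linear f"
  shows "Ck_on n S f"
proof (cases n)
  case 0
  then show ?thesis
    using assms(2) linear_continuous_on by (auto simp: Ck_on.simps)
next
  case (Suc m)
  then show ?thesis
    using assms by (auto intro!: Ck_on_SucI[where f'="\<lambda>_. f"] Ck_on_const
        bounded_linear_imp_has_derivative)
qed

text \<open>Lifts functions of \<open>q\<close> to the phase space. The derivative in direction
  \<open>v\<close> is again a lifted function, namely the derivative of \<open>f\<close> in the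
  fixed direction \<open>fst v\<close>, so the induction closes without a general chain
  rule.\<close>

lemma Ck_on_fst:
  assumes "open S" "open T" "Ck_on n S f"
  shows "Ck_on n (S \<times> T) (\<lambda>z. f (fst z))"
  using assms(3)
proof (induction n arbitrary: f)
  case 0
  then show ?case
    unfolding Ck_on.simps by (rule continuous_on_compose2) (auto intro: continuous_on_fst continuous_on_id)
next
  case (Suc n)
  let ?f' = "\<lambda>x. frechet_derivative f (at x)"
  have d: "((\<lambda>z. f (fst z)) has_derivative (\<lambda>v. ?f' (fst z) (fst v))) (at z)" if "z \<in> S \<times> T" for z
  proof (rule has_derivative_compose[of fst fst])
    show "(fst has_derivative fst) (at z)"
      by (rule bounded_linear_imp_has_derivative[OF bounded_linear_fst])
    show "(f has_derivative ?f' (fst z)) (at (fst z))"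
      using that by (intro Ck_on_has_derivative[OF Suc.prems]) auto
  qed
  show ?case
    by (rule Ck_on_SucI[OF open_Times[OF assms(1,2)] d])
      (assumption, rule Suc.IH[OF Ck_on_frechet_derivative[OF Suc.prems]])
qed

section \<open>Transfer to smooth functions\<close>

lemma smooth_on_cong: "open S \<Longrightarrow> smooth_on S f \<Longrightarrow> (\<And>x. x \<in> S \<Longrightarrow> f x = g x) \<Longrightarrow> smooth_on S g"
  unfolding smooth_on_def by (auto intro: Ck_on_cong[of S f g])

lemma smooth_on_const: "smooth_on S (\<lambda>x. k)"
  by (simp add: smooth_on_def Ck_on_const)

lemma smooth_on_add: "open S \<Longrightarrow> smooth_on S f \<Longrightarrow> smooth_on S g \<Longrightarrow> smooth_on S (\<lambda>x. f x + g x)"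
  by (simp add: smooth_on_def Ck_on_add)

lemma smooth_on_mult:
  fixes f g :: "_ \<Rightarrow> real"
  shows "open S \<Longrightarrow> smooth_on S f \<Longrightarrow> smooth_on S g \<Longrightarrow> smooth_on S (\<lambda>x. f x * g x)"
  by (simp add: smooth_on_def Ck_on_mult)

lemma smooth_on_minus:
  fixes f :: "_ \<Rightarrow> real"
  shows "open S \<Longrightarrow> smooth_on S f \<Longrightarrow> smooth_on S (\<lambda>x. - f x)"
  using smooth_on_mult[OF _ smooth_on_const[of S "-1"], of f] by simp

lemma smooth_on_diff:
  fixes f g :: "_ \<Rightarrow> real"
  shows "open S \<Longrightarrow> smooth_on S f \<Longrightarrow> smooth_on S g \<Longrightarrow> smooth_on S (\<lambda>x. f x - g x)"
  using smooth_on_add[OF _ _ smooth_on_minus, of S f g] by simp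

lemma smooth_on_divide:
  fixes f g :: "_ \<Rightarrow> real"
  shows "open S \<Longrightarrow> smooth_on S f \<Longrightarrow> smooth_on S g \<Longrightarrow> (\<And>x. x \<in> S \<Longrightarrow> g x \<noteq> 0) \<Longrightarrow>
    smooth_on S (\<lambda>x. f x / g x)"
  unfolding divide_inverse by (intro smooth_on_mult) (simp_all add: smooth_on_def Ck_on_inverse)

lemma smooth_on_bounded_linear: "open S \<Longrightarrow> bounded_linear f \<Longrightarrow> smooth_on S f"
  by (simp add: smooth_on_def Ck_on_bounded_linear)

lemma smooth_on_fst: "open S \<Longrightarrow> open T \<Longrightarrow> smooth_on S f \<Longrightarrow> smooth_on (S \<times> T) (\<lambda>z. f (fst z))"
  by (simp add: smooth_on_def Ck_on_fst)

lemma smooth_on_differentiable: "smooth_on S f \<Longrightarrow> z \<in> S \<Longrightarrow> f differentiable (at z)"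
  unfolding smooth_on_def using Ck_on.simps(2) by blast

lemma smooth_on_continuous: "smooth_on S f \<Longrightarrow> continuous_on S f"
  unfolding smooth_on_def using Ck_on.simps(1) by blast

lemma smooth_on_DERIV:
  "smooth_on S f \<Longrightarrow> z \<in> S \<Longrightarrow> ((\<lambda>t. f (z + t *\<^sub>R v)) has_real_derivative dir_deriv f z v) (at 0)"
  by (rule dir_deriv_frechet(2)[OF smooth_on_differentiable])

lemma smooth_on_dir_deriv:
  assumes "open S" "smooth_on S f"
  shows "smooth_on S (\<lambda>z. dir_deriv f z v)"
proof (rule smooth_on_cong[OF assms(1)])
  show "smooth_on S (\<lambda>z. frechet_derivative f (at z) v)"
    using assms(2) unfolding smooth_on_def using Ck_on.simps(2) by blast
  show "frechet_derivative f (at z) v = dir_deriv f z v" if "z \<in> S" for z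
    using assms(2) that by (simp add: dir_deriv_frechet smooth_on_differentiable)
qed

section \<open>Symmetry of second derivatives\<close>

lemma smooth_on_DERIV_line:
  assumes "smooth_on S f" "z + s *\<^sub>R v \<in> S"
  shows "((\<lambda>t. f (z + t *\<^sub>R v)) has_real_derivative dir_deriv f (z + s *\<^sub>R v) v) (at s)"
proof -
  have "((\<lambda>t. f ((z + s *\<^sub>R v) + t *\<^sub>R v)) has_real_derivative dir_deriv f (z + s *\<^sub>R v) v) (at 0)"
    by (rule smooth_on_DERIV[OF assms])
  then show ?thesis
    using DERIV_shift[of "\<lambda>t. f (z + t *\<^sub>R v)" _ 0 s] by (simp add: algebra_simps)
qed

text \<open>The mean value theorem is applied twice: in direction \<open>u\<close> to the increment
  \<open>f (y + h v) - f y\<close>, then in direction \<open>v\<close> to the derivative of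
  \<open>f\<close> along \<open>u\<close>.\<close>

lemma second_difference_mvt:
  assumes S: "open S" and f: "smooth_on S f"
    and h: "h > 0" "\<And>s t. 0 \<le> s \<Longrightarrow> s \<le> h \<Longrightarrow> 0 \<le> t \<Longrightarrow> t \<le> h \<Longrightarrow> z + s *\<^sub>R u + t *\<^sub>R v \<in> S"
  obtains s t where "0 \<le> s" "s \<le> h" "0 \<le> t" "t \<le> h"
    "f (z + h *\<^sub>R u + h *\<^sub>R v) - f (z + h *\<^sub>R u) - f (z + h *\<^sub>R v) + f z =
       h\<^sup>2 * dir_deriv (\<lambda>y. dir_deriv f y u) (z + s *\<^sub>R u + t *\<^sub>R v) v"
proof -
  have "\<exists>s>0. s < h \<and> (f ((z + h *\<^sub>R v) + h *\<^sub>R u) - f (z + h *\<^sub>R u)) - (f ((z + h *\<^sub>R v) + 0 *\<^sub>R u) - f (z + 0 *\<^sub>R u))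
      = (h - 0) * (dir_deriv f ((z + h *\<^sub>R v) + s *\<^sub>R u) u - dir_deriv f (z + s *\<^sub>R u) u)"
    by (intro MVT2[OF h(1)] DERIV_diff smooth_on_DERIV_line[OF f])
      (use h(2)[of _ h] h(2)[of _ 0] h(1) in \<open>auto simp: algebra_simps\<close>)
  then obtain s where s: "0 < s" "s < h" and 1: "f (z + h *\<^sub>R u + h *\<^sub>R v) - f (z + h *\<^sub>R u) - f (z + h *\<^sub>R v) + f z
      = h * (dir_deriv f (z + s *\<^sub>R u + h *\<^sub>R v) u - dir_deriv f (z + s *\<^sub>R u) u)"
    by (auto simp: algebra_simps)
  have "\<exists>t>0. t < h \<and> dir_deriv f ((z + s *\<^sub>R u) + h *\<^sub>R v) u - dir_deriv f ((z + s *\<^sub>R u) + 0 *\<^sub>R v) u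
      = (h - 0) * dir_deriv (\<lambda>y. dir_deriv f y u) ((z + s *\<^sub>R u) + t *\<^sub>R v) v"
    by (intro MVT2[OF h(1)] smooth_on_DERIV_line[OF smooth_on_dir_deriv[OF S f]]) (use s h(2) in auto)
  then obtain t where "0 < t" "t < h"
    "dir_deriv f (z + s *\<^sub>R u + h *\<^sub>R v) u - dir_deriv f (z + s *\<^sub>R u) u
      = h * dir_deriv (\<lambda>y. dir_deriv f y u) (z + s *\<^sub>R u + t *\<^sub>R v) v"
    by auto
  with 1 s show ?thesis
    by (intro that[of s t]) (auto simp: power2_eq_square)
qed

text \<open>The second difference is symmetric in \<open>u\<close> and \<open>v\<close>. By the mean
  value form, the two mixed derivatives therefore share a value at points arbitrarily close to
  \<open>z\<close>, which contradicts continuity if they differ at \<open>z\<close>.\<close>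

lemma dir_deriv_commute:
  assumes S: "open S" and f: "smooth_on S f" and z: "z \<in> S"
  shows "dir_deriv (\<lambda>y. dir_deriv f y u) z v = dir_deriv (\<lambda>y. dir_deriv f y v) z u"
proof (rule ccontr)
  define A where "A y = dir_deriv (\<lambda>y. dir_deriv f y u) y v" for y
  define B where "B y = dir_deriv (\<lambda>y. dir_deriv f y v) y u" for y
  assume "\<not> ?thesis"
  then have e: "\<bar>A z - B z\<bar> / 2 > 0" (is "?e > 0")
    by (simp add: A_def B_def)
  have cA: "continuous_on S A" and cB: "continuous_on S B"
    unfolding A_def B_def by (intro smooth_on_continuous smooth_on_dir_deriv S f)+
  have "\<forall>\<^sub>F y in nhds z. y \<in> S \<and> dist (A y) (A z) < ?e \<and> dist (B y) (B z) < ?e"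
    using cA cB S z
    by (intro eventually_conj eventually_nhds_in_open tendstoD[OF _ e])
      (auto simp: continuous_on_eq_continuous_at isCont_def tendsto_at_iff_tendsto_nhds)
  then obtain r where r: "r > 0" "\<And>y. dist y z < r \<Longrightarrow> y \<in> S \<and> dist (A y) (A z) < ?e \<and> dist (B y) (B z) < ?e"
    unfolding eventually_nhds_metric by blast
  \<comment> \<open>The parallelogram spanned by \<open>h u\<close> and \<open>h v\<close> stays
    within distance \<open>r / 2\<close> of \<open>z\<close>; the summand 1 keeps the denominator
    positive when both vectors are zero.\<close>
  define h where "h = r / (2 * (norm u + norm v + 1))"
  have n: "norm u + norm v + 1 > 0"
    by (simp add: add_nonneg_pos)
  then have h: "h > 0"
    using r(1) by (simp add: h_def)
  have near: "dist (z + s *\<^sub>R u + t *\<^sub>R v) z < r" if "0 \<le> s" "s \<le> h" "0 \<le> t" "t \<le> h" for s t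
  proof -
    have "dist (z + s *\<^sub>R u + t *\<^sub>R v) z = norm (s *\<^sub>R u + t *\<^sub>R v)"
      by (simp add: dist_norm add.assoc)
    also have "\<dots> \<le> s * norm u + t * norm v"
      using norm_triangle_ineq[of "s *\<^sub>R u" "t *\<^sub>R v"] that by simp
    also have "\<dots> \<le> h * norm u + h * norm v"
      using that by (intro add_mono mult_right_mono) auto
    also have "\<dots> \<le> h * (norm u + norm v + 1)"
      using h by (simp add: algebra_simps)
    also have "\<dots> = r / 2"
      using n by (simp add: h_def field_simps)
    finally show ?thesis
      using r(1) by simp
  qed
  have inS: "z + s *\<^sub>R u + t *\<^sub>R v \<in> S" "z + t *\<^sub>R v + s *\<^sub>R u \<in> S"
    if "0 \<le> s" "s \<le> h" "0 \<le> t" "t \<le> h" for s t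
    using r(2)[OF near[OF that]] by (simp_all add: algebra_simps)
  obtain s t where st: "0 \<le> s" "s \<le> h" "0 \<le> t" "t \<le> h" and
    1: "f (z + h *\<^sub>R u + h *\<^sub>R v) - f (z + h *\<^sub>R u) - f (z + h *\<^sub>R v) + f z = h\<^sup>2 * A (z + s *\<^sub>R u + t *\<^sub>R v)"
    unfolding A_def by (rule second_difference_mvt[OF S f h inS(1)])
  \<comment> \<open>The same with \<open>u\<close> and \<open>v\<close> exchanged, so here
    \<open>s'\<close> belongs to \<open>v\<close> and \<open>t'\<close> to \<open>u\<close>.\<close>
  obtain s' t' where st': "0 \<le> s'" "s' \<le> h" "0 \<le> t'" "t' \<le> h" and
    2: "f (z + h *\<^sub>R v + h *\<^sub>R u) - f (z + h *\<^sub>R v) - f (z + h *\<^sub>R u) + f z = h\<^sup>2 * B (z + s' *\<^sub>R v + t' *\<^sub>R u)"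
    unfolding B_def by (rule second_difference_mvt[OF S f h inS(2)])
  have "h\<^sup>2 * A (z + s *\<^sub>R u + t *\<^sub>R v) = h\<^sup>2 * B (z + t' *\<^sub>R u + s' *\<^sub>R v)"
    using 1 2 by (simp add: algebra_simps)
  then have "A (z + s *\<^sub>R u + t *\<^sub>R v) = B (z + t' *\<^sub>R u + s' *\<^sub>R v)"
    using h by simp
  moreover have "dist (A (z + s *\<^sub>R u + t *\<^sub>R v)) (A z) < ?e" "dist (B (z + t' *\<^sub>R u + s' *\<^sub>R v)) (B z) < ?e"
    using r(2)[OF near[OF st]] r(2)[OF near[OF st'(3,4,1,2)]] by simp_all
  ultimately have "dist (A z) (B z) < \<bar>A z - B z\<bar>"
    by (metis dist_triangle_half_r)
  then show False
    by (simp add: dist_real_def)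
qed

section \<open>Brackets on the phase space\<close>

abbreviation e\<^sub>q :: "2 \<Rightarrow> phase" where "e\<^sub>q i \<equiv> (axis i 1, 0)"
abbreviation e\<^sub>P :: "2 \<Rightarrow> phase" where "e\<^sub>P i \<equiv> (0, axis i 1)"

text \<open>The canonical bracket with a magnetic term, \<open>{P1, P2} = S\<close>, all multiplied
  by the conformal factor \<open>R\<close>. It is written in the original momenta \<open>P\<close>,
  so no change of variables is required.\<close>

definition magnetic_bracket ::
  "(phase \<Rightarrow> real) \<Rightarrow> (phase \<Rightarrow> real) \<Rightarrow> (phase \<Rightarrow> real) \<Rightarrow> (phase \<Rightarrow> real) \<Rightarrow> phase \<Rightarrow> real" where
  "magnetic_bracket R S f h z = R z *
     (dir_deriv f z (e\<^sub>q 1) * dir_deriv h z (e\<^sub>P 1) - dir_deriv f z (e\<^sub>P 1) * dir_deriv h z (e\<^sub>q 1) +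
      dir_deriv f z (e\<^sub>q 2) * dir_deriv h z (e\<^sub>P 2) - dir_deriv f z (e\<^sub>P 2) * dir_deriv h z (e\<^sub>q 2) +
      S z * (dir_deriv f z (e\<^sub>P 1) * dir_deriv h z (e\<^sub>P 2) - dir_deriv f z (e\<^sub>P 2) * dir_deriv h z (e\<^sub>P 1)))"

lemma dir_deriv_linear_combination:
  assumes "smooth_on M f" "smooth_on M h" "z \<in> M"
  shows "dir_deriv (\<lambda>y. \<alpha> * f y + \<beta> * h y) z v = \<alpha> * dir_deriv f z v + \<beta> * dir_deriv h z v"
proof -
  have "((\<lambda>t. \<alpha> * f (z + t *\<^sub>R v) + \<beta> * h (z + t *\<^sub>R v)) has_real_derivative
      \<alpha> * dir_deriv f z v + \<beta> * dir_deriv h z v) (at 0)"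
    by (rule derivative_eq_intros smooth_on_DERIV[OF assms(1,3)] smooth_on_DERIV[OF assms(2,3)] refl)+ simp
  then show ?thesis
    unfolding dir_deriv_def[of "\<lambda>y. \<alpha> * f y + \<beta> * h y"] by (rule DERIV_imp_deriv)
qed

lemma dir_deriv_mult:
  assumes "smooth_on M f" "smooth_on M h" "z \<in> M"
  shows "dir_deriv (\<lambda>y. f y * h y) z v = f z * dir_deriv h z v + h z * dir_deriv f z v"
proof -
  have "((\<lambda>t. f (z + t *\<^sub>R v) * h (z + t *\<^sub>R v)) has_real_derivative
      f z * dir_deriv h z v + h z * dir_deriv f z v) (at 0)"
    by (rule derivative_eq_intros smooth_on_DERIV[OF assms(1,3)] smooth_on_DERIV[OF assms(2,3)] refl)+ simp
  then show ?thesis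
    unfolding dir_deriv_def[of "\<lambda>y. f y * h y"] by (rule DERIV_imp_deriv)
qed

lemma smooth_on_magnetic_bracket:
  assumes "open M" "smooth_on M R" "smooth_on M S" "smooth_on M f" "smooth_on M h"
  shows "smooth_on M (magnetic_bracket R S f h)"
  unfolding magnetic_bracket_def[abs_def]
  by (intro smooth_on_mult smooth_on_add smooth_on_diff smooth_on_dir_deriv assms)

text \<open>The product rule written out in full, so that a nested bracket becomes a polynomial in
  the first and second derivatives of its arguments and the first derivatives of \<open>R\<close>
  and \<open>S\<close>.\<close>

lemma dir_deriv_magnetic_bracket:
  assumes M: "open M" "z \<in> M" and "smooth_on M R" "smooth_on M S" "smooth_on M f" "smooth_on M h"
  shows "dir_deriv (magnetic_bracket R S f h) z v =
    R z *
     (dir_deriv (\<lambda>y. dir_deriv f y (e\<^sub>q 1)) z v * dir_deriv h z (e\<^sub>P 1) + dir_deriv f z (e\<^sub>q 1) * dir_deriv (\<lambda>y. dir_deriv h y (e\<^sub>P 1)) z v -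
      dir_deriv (\<lambda>y. dir_deriv f y (e\<^sub>P 1)) z v * dir_deriv h z (e\<^sub>q 1) - dir_deriv f z (e\<^sub>P 1) * dir_deriv (\<lambda>y. dir_deriv h y (e\<^sub>q 1)) z v +
      dir_deriv (\<lambda>y. dir_deriv f y (e\<^sub>q 2)) z v * dir_deriv h z (e\<^sub>P 2) + dir_deriv f z (e\<^sub>q 2) * dir_deriv (\<lambda>y. dir_deriv h y (e\<^sub>P 2)) z v -
      dir_deriv (\<lambda>y. dir_deriv f y (e\<^sub>P 2)) z v * dir_deriv h z (e\<^sub>q 2) - dir_deriv f z (e\<^sub>P 2) * dir_deriv (\<lambda>y. dir_deriv h y (e\<^sub>q 2)) z v +
      S z *
       (dir_deriv (\<lambda>y. dir_deriv f y (e\<^sub>P 1)) z v * dir_deriv h z (e\<^sub>P 2) + dir_deriv f z (e\<^sub>P 1) * dir_deriv (\<lambda>y. dir_deriv h y (e\<^sub>P 2)) z v -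
        dir_deriv (\<lambda>y. dir_deriv f y (e\<^sub>P 2)) z v * dir_deriv h z (e\<^sub>P 1) - dir_deriv f z (e\<^sub>P 2) * dir_deriv (\<lambda>y. dir_deriv h y (e\<^sub>P 1)) z v) +
      dir_deriv S z v * (dir_deriv f z (e\<^sub>P 1) * dir_deriv h z (e\<^sub>P 2) - dir_deriv f z (e\<^sub>P 2) * dir_deriv h z (e\<^sub>P 1))) +
    dir_deriv R z v *
     (dir_deriv f z (e\<^sub>q 1) * dir_deriv h z (e\<^sub>P 1) - dir_deriv f z (e\<^sub>P 1) * dir_deriv h z (e\<^sub>q 1) +
      dir_deriv f z (e\<^sub>q 2) * dir_deriv h z (e\<^sub>P 2) - dir_deriv f z (e\<^sub>P 2) * dir_deriv h z (e\<^sub>q 2) +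
      S z * (dir_deriv f z (e\<^sub>P 1) * dir_deriv h z (e\<^sub>P 2) - dir_deriv f z (e\<^sub>P 2) * dir_deriv h z (e\<^sub>P 1)))"
proof -
  note D = smooth_on_DERIV[OF _ M(2), of _ v]
  have *: "((\<lambda>t. dir_deriv k (z + t *\<^sub>R v) w) has_real_derivative dir_deriv (\<lambda>y. dir_deriv k y w) z v) (at 0)"
    if "smooth_on M k" for k w
    using D[OF smooth_on_dir_deriv[OF M(1) that]] .
  show ?thesis
    unfolding dir_deriv_def[of "magnetic_bracket R S f h"] magnetic_bracket_def
    by (rule DERIV_imp_deriv, (rule derivative_eq_intros *[OF assms(5)] *[OF assms(6)] D[OF assms(3)] D[OF assms(4)] refl)+)
      (simp add: algebra_simps)
qed

text \<open>The second derivatives of \<open>f\<close>, \<open>h\<close>, \<open>k\<close> cancel in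
  the cyclic sum by symmetry. What is left involves derivatives of \<open>R\<close> and
  \<open>S\<close>, and cancels by the four equations assumed for them. For \<open>R = 1 / N\<close>
  these are the equations that invariance of the measure yields.\<close>

lemma magnetic_bracket_jacobi:
  assumes M: "open M" "z \<in> M" and R: "smooth_on M R" and S: "smooth_on M S"
    and RS: "dir_deriv R z (e\<^sub>P 1) = 0" "dir_deriv R z (e\<^sub>P 2) = 0"
      "dir_deriv R z (e\<^sub>q 1) = - R z * dir_deriv S z (e\<^sub>P 2)"
      "dir_deriv R z (e\<^sub>q 2) = R z * dir_deriv S z (e\<^sub>P 1)"
    and f: "smooth_on M f" and h: "smooth_on M h" and k: "smooth_on M k"
  shows "magnetic_bracket R S f (magnetic_bracket R S h k) z +
    magnetic_bracket R S h (magnetic_bracket R S k f) z +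
    magnetic_bracket R S k (magnetic_bracket R S f h) z = 0"
proof -
  note c = dir_deriv_commute[OF M(1) _ M(2)]
  \<comment> \<open>Each mixed second derivative gets a single normal form, so that
    \<open>algebra\<close> recognises equal terms.\<close>
  have comm: "dir_deriv (\<lambda>y. dir_deriv F y (e\<^sub>q 2)) z (e\<^sub>q 1) = dir_deriv (\<lambda>y. dir_deriv F y (e\<^sub>q 1)) z (e\<^sub>q 2)"
     "dir_deriv (\<lambda>y. dir_deriv F y (e\<^sub>P 2)) z (e\<^sub>P 1) = dir_deriv (\<lambda>y. dir_deriv F y (e\<^sub>P 1)) z (e\<^sub>P 2)"
     "dir_deriv (\<lambda>y. dir_deriv F y (e\<^sub>P i)) z (e\<^sub>q j) = dir_deriv (\<lambda>y. dir_deriv F y (e\<^sub>q j)) z (e\<^sub>P i)"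
    if "smooth_on M F" for F i j
    by (rule c[OF that])+
  show ?thesis
    \<comment> \<open>Only the outer brackets are unfolded; the inner ones must stay folded for the
      derivative formula to apply.\<close>
    unfolding magnetic_bracket_def[of R S _ "magnetic_bracket R S _ _"]
      dir_deriv_magnetic_bracket[OF M R S f h] dir_deriv_magnetic_bracket[OF M R S h k]
      dir_deriv_magnetic_bracket[OF M R S k f] comm[OF f] comm[OF h] comm[OF k] RS
    by algebra
qed

lemma poisson_bracket_on_magnetic:
  assumes M: "open M" and R: "smooth_on M R" and S: "smooth_on M S"
    and RS: "\<And>z i. z \<in> M \<Longrightarrow> dir_deriv R z (e\<^sub>P i) = 0"
      "\<And>z. z \<in> M \<Longrightarrow> dir_deriv R z (e\<^sub>q 1) = - R z * dir_deriv S z (e\<^sub>P 2)"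
      "\<And>z. z \<in> M \<Longrightarrow> dir_deriv R z (e\<^sub>q 2) = R z * dir_deriv S z (e\<^sub>P 1)"
  shows "poisson_bracket_on M (magnetic_bracket R S)"
  unfolding poisson_bracket_on_def
proof (intro conjI allI impI ballI; (elim conjE)?)
  fix f h :: "phase \<Rightarrow> real" and z assume "smooth_on M f" "smooth_on M h"
  then show "smooth_on M (magnetic_bracket R S f h)"
    by (rule smooth_on_magnetic_bracket[OF M R S])
next
  fix f f' h :: "phase \<Rightarrow> real" and z assume "\<forall>z\<in>M. f z = f' z" "z \<in> M"
  then have "dir_deriv f z v = dir_deriv f' z v" for v
    using dir_deriv_cong_open[OF M, of z f f' v] by blast
  then show "magnetic_bracket R S f h z = magnetic_bracket R S f' h z"
    by (simp add: magnetic_bracket_def)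
next
  fix f h :: "phase \<Rightarrow> real" and z show "magnetic_bracket R S h f z = - magnetic_bracket R S f h z"
    by (simp add: magnetic_bracket_def algebra_simps)
next
  fix f h k :: "phase \<Rightarrow> real" and \<alpha> \<beta> z assume "smooth_on M f" "smooth_on M h" "z \<in> M"
  note d = dir_deriv_linear_combination[OF this]
  show "magnetic_bracket R S (\<lambda>y. \<alpha> * f y + \<beta> * h y) k z =
      \<alpha> * magnetic_bracket R S f k z + \<beta> * magnetic_bracket R S h k z"
    unfolding magnetic_bracket_def d by algebra
next
  fix f h k :: "phase \<Rightarrow> real" and z assume "smooth_on M f" "smooth_on M h" "z \<in> M"
  note d = dir_deriv_mult[OF this]
  show "magnetic_bracket R S (\<lambda>y. f y * h y) k z =
      f z * magnetic_bracket R S h k z + h z * magnetic_bracket R S f k z"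
    unfolding magnetic_bracket_def d by algebra
next
  fix f h k :: "phase \<Rightarrow> real" and z assume "smooth_on M f" "smooth_on M h" "smooth_on M k" "z \<in> M"
  then show "magnetic_bracket R S f (magnetic_bracket R S h k) z +
      magnetic_bracket R S h (magnetic_bracket R S k f) z +
      magnetic_bracket R S k (magnetic_bracket R S f h) z = 0"
    by (intro magnetic_bracket_jacobi[OF M _ R S] RS)
qed

section \<open>The reduced system\<close>

locale constrained_system =
  fixes D :: "(real^2) set"
    and g :: "real^2 \<Rightarrow> real^3^3"
    and c :: "real^2 \<Rightarrow> real^3"
    and U a1 a2 :: "real^2 \<Rightarrow> real"
  assumes open_D: "open D"
    and smooth_g: "\<And>i j. smooth_on D (\<lambda>q. g q $ i $ j)"
    and smooth_c: "\<And>i. smooth_on D (\<lambda>q. c q $ i)"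
    and smooth_U: "smooth_on D U"
    and smooth_a1: "smooth_on D a1"
    and smooth_a2: "smooth_on D a2"
    and sym_g: "\<And>q. q \<in> D \<Longrightarrow> transpose (g q) = g q"
    and nondeg: "\<And>q. q \<in> D \<Longrightarrow> nondegenerate_form (constrained_form a1 a2 g q)"
begin

text \<open>\<open>L\<^sup>*\<close> is \<open>u \<cdot> G u / 2 + k \<cdot> u - U\<close>, so that the velocity is \<open>G\<inverse> (P - k)\<close>, with \<open>G\<inverse>\<close> given by
  Cramer's rule.\<close>

definition "G11 q = g q $ 1 $ 1 + 2 * a1 q * g q $ 1 $ 3 + a1 q * a1 q * g q $ 3 $ 3"
definition "G12 q = g q $ 1 $ 2 + a2 q * g q $ 1 $ 3 + a1 q * g q $ 2 $ 3 + a1 q * a2 q * g q $ 3 $ 3"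
definition "G22 q = g q $ 2 $ 2 + 2 * a2 q * g q $ 2 $ 3 + a2 q * a2 q * g q $ 3 $ 3"
definition "\<Delta> q = G11 q * G22 q - G12 q * G12 q"
definition "k1 q = c q $ 1 + a1 q * c q $ 3"
definition "k2 q = c q $ 2 + a2 q * c q $ 3"

definition "u1 (z :: phase) = (G22 (fst z) * (snd z $ 1 - k1 (fst z)) - G12 (fst z) * (snd z $ 2 - k2 (fst z))) / \<Delta> (fst z)"
definition "u2 (z :: phase) = (G11 (fst z) * (snd z $ 2 - k2 (fst z)) - G12 (fst z) * (snd z $ 1 - k1 (fst z))) / \<Delta> (fst z)"

abbreviation "Ls \<equiv> constrained_lagrangian a1 a2 (lagrangian g c U)"
abbreviation "H \<equiv> reduced_hamiltonian Ls"
abbreviation "\<kappa> q \<equiv> dir_deriv a1 q (axis 2 1) - dir_deriv a2 q (axis 1 1)"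
abbreviation "S z \<equiv> curvature_term a1 a2 (lagrangian g c U) (fst z) (legendre_velocity Ls z)"

section \<open>The Legendre transform in explicit form\<close>

lemma g_sym: "q \<in> D \<Longrightarrow> g q $ i $ j = g q $ j $ i"
  using arg_cong[OF sym_g, of q "\<lambda>A. A $ j $ i"] by (simp add: transpose_def)

lemma constrained_form_G:
  assumes "q \<in> D"
  shows "constrained_form a1 a2 g q u u' =
    G11 q * u $ 1 * u' $ 1 + G12 q * (u $ 1 * u' $ 2 + u $ 2 * u' $ 1) + G22 q * u $ 2 * u' $ 2"
  by (simp add: constrained_form_def constrained_velocity_def sum_3 G11_def G12_def G22_def
      g_sym[OF assms, of 2 1] g_sym[OF assms, of 3 1] g_sym[OF assms, of 3 2] algebra_simps)

text \<open>Nondegeneracy says that the matrix \<open>G\<close> has trivial kernel. If its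
  determinant vanished, the vectors \<open>(G22, -G12)\<close> and \<open>(G12, -G11)\<close> would
  lie in the kernel, hence \<open>G = 0\<close>, and then \<open>(1, 1)\<close> would lie there
  too.\<close>

lemma \<Delta>_nonzero:
  assumes q: "q \<in> D"
  shows "\<Delta> q \<noteq> 0"
proof
  assume "\<Delta> q = 0"
  then have d: "G11 q * G22 q = G12 q * G12 q"
    by (simp add: \<Delta>_def)
  have k: "x = 0 \<and> y = 0" if "G11 q * x + G12 q * y = 0" "G12 q * x + G22 q * y = 0" for x y
  proof -
    have "constrained_form a1 a2 g q (vector [x, y]) u' =
        (G11 q * x + G12 q * y) * u' $ 1 + (G12 q * x + G22 q * y) * u' $ 2" for u'
      by (simp add: constrained_form_G[OF q] algebra_simps)
    then have "vector [x, y] = (0 :: real^2)"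
      using that nondeg[OF q] by (simp add: nondegenerate_form_def)
    then show ?thesis
      by (simp add: vec_eq_iff forall_2)
  qed
  have "G22 q = 0 \<and> - G12 q = 0" "G12 q = 0 \<and> - G11 q = 0"
    by (rule k; use d in \<open>simp add: algebra_simps\<close>)+
  then show False
    using k[of 1 1] by simp
qed

lemma velocity_solves:
  assumes "fst z \<in> D"
  shows "G11 (fst z) * u1 z + G12 (fst z) * u2 z = snd z $ 1 - k1 (fst z)"
    and "G12 (fst z) * u1 z + G22 (fst z) * u2 z = snd z $ 2 - k2 (fst z)"
  using \<Delta>_nonzero[OF assms] unfolding u1_def u2_def
  \<comment> \<open>\<open>\<Delta>\<close> stays folded while it is cleared as a denominator and is
    expanded only afterwards.\<close>
  by (simp_all add: field_simps, simp_all add: \<Delta>_def algebra_simps)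

text \<open>The velocity is a definite description, so by uniqueness it suffices that the Cramer
  solution has the prescribed momentum.\<close>

lemma legendre_velocity_eq:
  assumes "fst z \<in> D"
  shows "legendre_velocity Ls z = vector [u1 z, u2 z]"
  unfolding legendre_velocity_def
proof (rule the1_equality[OF legendre_momentum_ex1[OF sym_g[OF assms] nondeg[OF assms]]])
  show "legendre_momentum Ls (fst z) (vector [u1 z, u2 z]) = snd z"
    using velocity_solves[OF assms]
    by (simp add: vec_eq_iff forall_2 legendre_momentum_lagrangian[of g "fst z", OF sym_g[OF assms]]
        constrained_form_G[OF assms] constrained_velocity_def sum_3 k1_def k2_def axis_def algebra_simps)
qed

lemma constrained_lagrangian_G:
  assumes "q \<in> D"
  shows "Ls q u = (G11 q * u $ 1 * u $ 1 + 2 * G12 q * u $ 1 * u $ 2 + G22 q * u $ 2 * u $ 2) / 2 +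
    k1 q * u $ 1 + k2 q * u $ 2 - U q"
  by (simp add: constrained_lagrangian_def lagrangian_def constrained_velocity_def sum_3 G11_def G12_def G22_def
      k1_def k2_def g_sym[OF assms, of 2 1] g_sym[OF assms, of 3 1] g_sym[OF assms, of 3 2] field_simps)

text \<open>Since \<open>G u = P - k\<close>, subtracting \<open>L*\<close> from
  \<open>P . u\<close> leaves half of \<open>u . G u\<close> plus the potential.\<close>

lemma hamiltonian_eq:
  assumes z: "fst z \<in> D"
  shows "H z = (u1 z * (snd z $ 1 - k1 (fst z)) + u2 z * (snd z $ 2 - k2 (fst z))) / 2 + U (fst z)"
proof -
  have "H z = snd z $ 1 * u1 z + snd z $ 2 * u2 z - Ls (fst z) (vector [u1 z, u2 z])"
    by (simp add: reduced_hamiltonian_def legendre_velocity_eq[OF z] sum_2)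
  also have "\<dots> = (u1 z * (snd z $ 1 - k1 (fst z)) + u2 z * (snd z $ 2 - k2 (fst z))) / 2 + U (fst z)"
    unfolding constrained_lagrangian_G[OF z] vector_2 using velocity_solves[OF z] by algebra
  finally show ?thesis .
qed

lemma dir_deriv_hamiltonian_momentum:
  assumes "q \<in> D"
  shows "dir_deriv H (q, P) (e\<^sub>P 1) = u1 (q, P)" "dir_deriv H (q, P) (e\<^sub>P 2) = u2 (q, P)"
  unfolding dir_deriv_def using \<Delta>_nonzero[OF assms]
  by (auto simp: hamiltonian_eq assms u1_def u2_def axis_def
      intro!: DERIV_imp_deriv derivative_eq_intros) (simp_all add: field_simps)

text \<open>\<open>\<partial>S/\<partial>P\<^sub>1\<close> and \<open>\<partial>S/\<partial>P\<^sub>2\<close>, which do not depend on the momenta.\<close>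

definition "S1 q = ((g q $ 1 $ 3 + g q $ 3 $ 3 * a1 q) * G22 q - (g q $ 2 $ 3 + g q $ 3 $ 3 * a2 q) * G12 q) / \<Delta> q * \<kappa> q"
definition "S2 q = ((g q $ 2 $ 3 + g q $ 3 $ 3 * a2 q) * G11 q - (g q $ 1 $ 3 + g q $ 3 $ 3 * a1 q) * G12 q) / \<Delta> q * \<kappa> q"

text \<open>The momentum conjugate to the third velocity is \<open>\<Sum>i. g_i3 w_i + c_3\<close>;
  inserting the constraint for \<open>w_3\<close> makes \<open>S\<close> visibly affine in the
  velocity, hence in \<open>P\<close>.\<close>

lemma curvature_term_eq:
  assumes z: "fst z \<in> D"
  shows "S z = ((g (fst z) $ 1 $ 3 + g (fst z) $ 3 $ 3 * a1 (fst z)) * u1 z +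
    (g (fst z) $ 2 $ 3 + g (fst z) $ 3 $ 3 * a2 (fst z)) * u2 z + c (fst z) $ 3) * \<kappa> (fst z)"
proof -
  let ?q = "fst z"
  let ?w = "constrained_velocity a1 a2 ?q (vector [u1 z, u2 z])"
  have "((\<lambda>t. lagrangian g c U ?q (?w + t *\<^sub>R axis 3 1)) has_real_derivative
      (\<Sum>i\<in>UNIV. g ?q $ i $ 3 * ?w $ i) + c ?q $ 3) (at 0)"
    unfolding lagrangian_def sum_3 vector_add_component vector_scaleR_component real_scaleR_def
    by (rule derivative_eq_intros refl)+
      (simp add: axis_def g_sym[OF z, of 3 1] g_sym[OF z, of 3 2] algebra_simps)
  then show ?thesis
    unfolding curvature_term_def legendre_velocity_eq[OF z] dir_deriv_def[of "lagrangian g c U ?q"]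
    by (simp add: DERIV_imp_deriv sum_3 constrained_velocity_def algebra_simps)
qed

lemma dir_deriv_curvature_momentum:
  assumes "q \<in> D"
  shows "dir_deriv (\<lambda>z. S z) (q, P) (e\<^sub>P 1) = S1 q" "dir_deriv (\<lambda>z. S z) (q, P) (e\<^sub>P 2) = S2 q"
  unfolding dir_deriv_def[of "\<lambda>z. S z"] using \<Delta>_nonzero[OF assms]
  by (auto simp: curvature_term_eq[of "(q, _)", unfolded fst_conv, OF assms] u1_def u2_def S1_def S2_def axis_def
      intro!: DERIV_imp_deriv derivative_eq_intros) (simp_all add: field_simps)

section \<open>Smoothness on the phase space\<close>

lemma open_phase: "open (D \<times> (UNIV :: (real^2) set))"
  by (intro open_Times open_D open_UNIV)

lemma smooth_on_momentum: "smooth_on (D \<times> UNIV) (\<lambda>z :: phase. snd z $ i)"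
  by (intro smooth_on_bounded_linear open_phase bounded_linear_compose[OF bounded_linear_vec_nth bounded_linear_snd])

lemma smooth_on_fst_D: "smooth_on D f \<Longrightarrow> smooth_on (D \<times> UNIV) (\<lambda>z. f (fst z))"
  by (intro smooth_on_fst open_D open_UNIV)

lemma smooth_coeffs: "smooth_on D G11" "smooth_on D G12" "smooth_on D G22" "smooth_on D \<Delta>" "smooth_on D k1" "smooth_on D k2"
  unfolding G11_def[abs_def] G12_def[abs_def] G22_def[abs_def] \<Delta>_def[abs_def] k1_def[abs_def] k2_def[abs_def]
  by (intro smooth_on_add smooth_on_diff smooth_on_mult smooth_on_const open_D smooth_g smooth_c smooth_a1 smooth_a2)+

lemma smooth_velocity: "smooth_on (D \<times> UNIV) u1" "smooth_on (D \<times> UNIV) u2"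
  unfolding u1_def[abs_def] u2_def[abs_def]
  by (intro smooth_on_divide smooth_on_diff smooth_on_mult open_phase smooth_on_momentum smooth_on_fst_D smooth_coeffs;
      use \<Delta>_nonzero in auto)+

text \<open>\<open>H\<close> is defined through a definite description; its smoothness is carried
  over from the explicit formula, which agrees with it over \<open>D\<close>.\<close>

lemma smooth_hamiltonian: "smooth_on (D \<times> UNIV) H"
proof (rule smooth_on_cong[OF open_phase])
  show "smooth_on (D \<times> UNIV) (\<lambda>z. (u1 z * (snd z $ 1 - k1 (fst z)) + u2 z * (snd z $ 2 - k2 (fst z))) / 2 + U (fst z))"
    by (intro smooth_on_add smooth_on_divide smooth_on_diff smooth_on_mult smooth_on_const open_phase smooth_on_momentum
        smooth_on_fst_D smooth_coeffs smooth_velocity smooth_U) simp_all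
qed (auto simp: hamiltonian_eq)

lemma smooth_curvature: "smooth_on (D \<times> UNIV) (\<lambda>z. S z)"
proof (rule smooth_on_cong[OF open_phase])
  show "smooth_on (D \<times> UNIV) (\<lambda>z :: phase. ((g (fst z) $ 1 $ 3 + g (fst z) $ 3 $ 3 * a1 (fst z)) * u1 z +
    (g (fst z) $ 2 $ 3 + g (fst z) $ 3 $ 3 * a2 (fst z)) * u2 z + c (fst z) $ 3) * \<kappa> (fst z))"
    by (intro smooth_on_add smooth_on_diff smooth_on_mult open_phase smooth_on_fst_D[OF smooth_g] smooth_on_fst_D[OF smooth_c]
        smooth_on_fst_D[OF smooth_a1] smooth_on_fst_D[OF smooth_a2] smooth_velocity
        smooth_on_fst_D[OF smooth_on_dir_deriv] open_D smooth_a1 smooth_a2)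
qed (rule curvature_term_eq[symmetric], auto)

section \<open>The divergence of the weighted reduced field\<close>

lemma reduced_field_eq: "reduced_field a1 a2 (lagrangian g c U) z =
  (vector [dir_deriv H z (e\<^sub>P 1), dir_deriv H z (e\<^sub>P 2)],
   vector [- dir_deriv H z (e\<^sub>q 1) + dir_deriv H z (e\<^sub>P 2) * S z, - dir_deriv H z (e\<^sub>q 2) - dir_deriv H z (e\<^sub>P 1) * S z])"
  by (simp add: reduced_field_def Let_def)

lemma divergence_phase:
  "divergence X z = dir_deriv (\<lambda>y. fst (X y) $ 1) z (e\<^sub>q 1) + dir_deriv (\<lambda>y. fst (X y) $ 2) z (e\<^sub>q 2) +
    dir_deriv (\<lambda>y. snd (X y) $ 1) z (e\<^sub>P 1) + dir_deriv (\<lambda>y. snd (X y) $ 2) z (e\<^sub>P 2)" for z :: phase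
proof -
  have b: "(Basis :: phase set) = {e\<^sub>q 1, e\<^sub>q 2, e\<^sub>P 1, e\<^sub>P 2}"
    by (auto simp: Basis_prod_def Basis_vec_def UNIV_2)
  \<comment> \<open>Distinctness makes the sum over the basis set split into four separate
    terms.\<close>
  have "distinct [e\<^sub>q 1, e\<^sub>q 2, e\<^sub>P 1, e\<^sub>P 2]"
    by (simp add: axis_eq_axis axis_eq_0_iff)
  then show ?thesis
    unfolding divergence_def b by (simp add: inner_prod_def inner_axis)
qed

text \<open>The canonical part drops out by symmetry of second derivatives. In the magnetic part the
  two terms \<open>S\<close> times the mixed derivative of \<open>H\<close> in \<open>P1\<close>,
  \<open>P2\<close> cancel, leaving \<open>u2 S1 - u1 S2\<close>. The density contributes its
  derivative along the velocity only, as it does not depend on \<open>P\<close>.\<close>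

lemma divergence_reduced_field:
  assumes z: "z \<in> D \<times> UNIV" and N: "smooth_on D N"
  shows "divergence (\<lambda>y. N (fst y) *\<^sub>R reduced_field a1 a2 (lagrangian g c U) y) z =
    dir_deriv N (fst z) (axis 1 1) * u1 z + dir_deriv N (fst z) (axis 2 1) * u2 z +
    N (fst z) * (u2 z * S1 (fst z) - u1 z * S2 (fst z))"
proof -
  have NM: "smooth_on (D \<times> UNIV) (\<lambda>z. N (fst z))"
    by (rule smooth_on_fst_D[OF N])
  have Nq: "dir_deriv (\<lambda>y. N (fst y)) z (e\<^sub>q i) = dir_deriv N (fst z) (axis i 1)" for i
    by (simp add: dir_deriv_def)
  have NP: "dir_deriv (\<lambda>y. N (fst y)) z (e\<^sub>P i) = 0" for i
    by (simp add: dir_deriv_def)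
  have sH: "smooth_on (D \<times> UNIV) (\<lambda>y. dir_deriv H y v)" for v
    by (rule smooth_on_dir_deriv[OF open_phase smooth_hamiltonian])
  have comm: "dir_deriv (\<lambda>y. dir_deriv H y (e\<^sub>P i)) z (e\<^sub>q j) = dir_deriv (\<lambda>y. dir_deriv H y (e\<^sub>q j)) z (e\<^sub>P i)"
    "dir_deriv (\<lambda>y. dir_deriv H y (e\<^sub>P 2)) z (e\<^sub>P 1) = dir_deriv (\<lambda>y. dir_deriv H y (e\<^sub>P 1)) z (e\<^sub>P 2)" for i j
    by (rule dir_deriv_commute[OF open_phase smooth_hamiltonian z])+
  have HP: "dir_deriv H z (e\<^sub>P 1) = u1 z" "dir_deriv H z (e\<^sub>P 2) = u2 z"
    using dir_deriv_hamiltonian_momentum[of "fst z" "snd z"] z by auto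
  have SP: "dir_deriv (\<lambda>z. S z) z (e\<^sub>P 1) = S1 (fst z)" "dir_deriv (\<lambda>z. S z) z (e\<^sub>P 2) = S2 (fst z)"
    using dir_deriv_curvature_momentum[of "fst z" "snd z"] z by auto
  have lin: "dir_deriv (\<lambda>y. - f y + h y) z v = - dir_deriv f z v + dir_deriv h z v"
     "dir_deriv (\<lambda>y. - f y - h y) z v = - dir_deriv f z v - dir_deriv h z v"
     "dir_deriv (\<lambda>y. h y - f y) z v = dir_deriv h z v - dir_deriv f z v"
    if "smooth_on (D \<times> UNIV) f" "smooth_on (D \<times> UNIV) h" for f h v
    using dir_deriv_linear_combination[OF that z, of "-1" 1 v] dir_deriv_linear_combination[OF that z, of "-1" "-1" v]
    by simp_all
  note mult = dir_deriv_mult[OF _ _ z]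
  note sm = smooth_on_add[OF open_phase] smooth_on_diff[OF open_phase] smooth_on_minus[OF open_phase]
    smooth_on_mult[OF open_phase] sH smooth_curvature
  show ?thesis
    unfolding divergence_phase reduced_field_eq fst_scaleR snd_scaleR vector_scaleR_component real_scaleR_def
      fst_conv snd_conv vector_2
    by (simp add: mult NM sm lin Nq NP comm HP SP) (simp add: algebra_simps)
qed

text \<open>Over a fixed \<open>q\<close> the divergence is a linear form in the velocity. It
  vanishes for every velocity, so both of its coefficients vanish.\<close>

lemma curvature_of_invariant_measure:
  assumes q: "q \<in> D" and N: "smooth_on D N"
    and inv: "invariant_measure_density_on (D \<times> UNIV) (reduced_field a1 a2 (lagrangian g c U)) (\<lambda>z. N (fst z))"
  shows "dir_deriv N q (axis 1 1) = N q * S2 q" "dir_deriv N q (axis 2 1) = - N q * S1 q"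
proof -
  \<comment> \<open>The momentum \<open>G (x, y) + k\<close> belonging to the velocity
    \<open>(x, y)\<close>.\<close>
  define P where "P x y = (vector [G11 q * x + G12 q * y + k1 q, G12 q * x + G22 q * y + k2 q] :: real^2)" for x y
  have u: "u1 (q, P x y) = x" "u2 (q, P x y) = y" for x y
    using \<Delta>_nonzero[OF q] by (simp_all add: u1_def u2_def P_def field_simps) (simp_all add: \<Delta>_def algebra_simps)
  have "dir_deriv N q (axis 1 1) * x + dir_deriv N q (axis 2 1) * y + N q * (y * S1 q - x * S2 q) = 0" for x y
    using inv divergence_reduced_field[OF _ N, of "(q, P x y)"] q
    by (simp add: invariant_measure_density_on_def u)
  from this[of 1 0] this[of 0 1] show "dir_deriv N q (axis 1 1) = N q * S2 q" "dir_deriv N q (axis 2 1) = - N q * S1 q"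
    by simp_all
qed

end

section \<open>Global coordinates with values in \<open>real^4\<close>\<close>

definition phase_coordinates :: "phase \<Rightarrow> real^4" where
  "phase_coordinates z = vector [fst z $ 1, fst z $ 2, snd z $ 1, snd z $ 2]"

lemma vector_4:
  "(vector [x, y, z, w] :: 'a::zero^4) $ 1 = x" "(vector [x, y, z, w] :: 'a^4) $ 2 = y"
  "(vector [x, y, z, w] :: 'a^4) $ 3 = z" "(vector [x, y, z, w] :: 'a^4) $ 4 = w"
  unfolding vector_def by simp_all

lemma linear_phase_coordinates: "linear phase_coordinates"
  by (rule linearI) (simp_all add: phase_coordinates_def vec_eq_iff forall_4 vector_4)

lemma global_coordinates_phase:
  assumes "open M"
  shows "global_coordinates_on M phase_coordinates"
proof -
  define y :: "real^4 \<Rightarrow> phase" where "y w = (vector [w $ 1, w $ 2], vector [w $ 3, w $ 4])" for w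
  have y: "y (phase_coordinates z) = z" for z
    by (cases z) (simp add: y_def phase_coordinates_def vector_4 vec_eq_iff forall_2)
  have y': "phase_coordinates (y w) = w" for w
    by (simp add: y_def phase_coordinates_def vector_4 vec_eq_iff forall_4)
  have inj: "inj phase_coordinates"
    by (metis injI y)
  have op: "open (phase_coordinates ` M)"
    by (rule open_surjective_linear_image[OF assms linear_phase_coordinates surjI[where f=y, OF y']])
  have "linear y"
    by (rule linearI) (simp_all add: y_def vec_eq_iff forall_2)
  then have "smooth_on (phase_coordinates ` M) y"
    by (intro smooth_on_bounded_linear op) (simp add: linear_conv_bounded_linear)
  \<comment> \<open>\<open>inv_into\<close> agrees with the linear inverse \<open>y\<close> on the
    image of \<open>M\<close>, which is open; this is enough to transfer smoothness.\<close>
  then have "smooth_on (phase_coordinates ` M) (inv_into M phase_coordinates)"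
    by (rule smooth_on_cong[OF op]) (use inj y in \<open>auto simp: inv_into_f_f inj_on_subset\<close>)
  then show ?thesis
    using assms op inj linear_phase_coordinates
    by (auto simp: global_coordinates_on_def linear_conv_bounded_linear intro: smooth_on_bounded_linear inj_on_subset)
qed

lemma dir_deriv_phase_coordinates: "dir_deriv (\<lambda>z. phase_coordinates z $ k) z v = phase_coordinates v $ k"
proof -
  have "((\<lambda>t. phase_coordinates z $ k + t * phase_coordinates v $ k) has_real_derivative phase_coordinates v $ k) (at 0)"
    by (auto intro!: derivative_eq_intros)
  then show ?thesis
    by (simp add: dir_deriv_def linear_add[OF linear_phase_coordinates] linear_cmul[OF linear_phase_coordinates] DERIV_imp_deriv)
qed

theorem theorem1:
  fixes D :: "(real^2) set"
    and g :: "real^2 \<Rightarrow> real^3^3"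
    and c :: "real^2 \<Rightarrow> real^3"
    and U a1 a2 :: "real^2 \<Rightarrow> real"
    and N :: "real^2 \<Rightarrow> real"
  assumes "open D"
    and "\<And>i j. smooth_on D (\<lambda>q. g q $ i $ j)"
    and "\<And>i. smooth_on D (\<lambda>q. c q $ i)"
    and "smooth_on D U"
    and "smooth_on D a1"
    and "smooth_on D a2"
    and "\<And>q. q \<in> D \<Longrightarrow> transpose (g q) = g q"
    and "\<exists>q\<in>D. dir_deriv a1 q (axis 2 1) \<noteq> dir_deriv a2 q (axis 1 1)"
    and "\<And>q. q \<in> D \<Longrightarrow> nondegenerate_form (constrained_form a1 a2 g q)"
    and "smooth_on D N"
    and "\<And>q. q \<in> D \<Longrightarrow> N q > 0"
    and "invariant_measure_density_on (D \<times> UNIV)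
           (reduced_field a1 a2 (lagrangian g c U)) (\<lambda>z. N (fst z))"
  shows "conformally_hamiltonian_on D (reduced_field a1 a2 (lagrangian g c U))"
proof -
  interpret constrained_system D g c U a1 a2
    using assms by unfold_locales
  \<comment> \<open>The reciprocal of the time rescaling \<open>N\<close>, so that the factor
    \<open>\<rho> = N\<close> cancels it in the equations of motion.\<close>
  define R where "R z = 1 / N (fst z)" for z :: phase
  define B where "B = magnetic_bracket R (\<lambda>z. S z)"
  note N = curvature_of_invariant_measure[OF _ assms(10,12)]
  have R: "smooth_on (D \<times> UNIV) R"
    unfolding R_def[abs_def]
    by (intro smooth_on_divide smooth_on_const smooth_on_fst_D assms(10) open_phase) (use assms(11) in force)
  have RP: "dir_deriv R z (e\<^sub>P i) = 0" for z i
    by (simp add: R_def dir_deriv_def)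
  have Rq: "dir_deriv R z (e\<^sub>q i) = - dir_deriv N (fst z) (axis i 1) / (N (fst z))\<^sup>2" if "fst z \<in> D" for z i
  proof -
    have "((\<lambda>t. 1 / N (fst z + t *\<^sub>R axis i 1)) has_real_derivative
        - dir_deriv N (fst z) (axis i 1) / (N (fst z))\<^sup>2) (at 0)"
      by (rule derivative_eq_intros smooth_on_DERIV[OF assms(10) that] refl)+
        (use assms(11)[OF that] in \<open>simp_all add: power2_eq_square\<close>)
    then show ?thesis
      by (simp add: dir_deriv_def[of R] R_def DERIV_imp_deriv)
  qed
  have "poisson_bracket_on (D \<times> UNIV) B"
    unfolding B_def
  proof (rule poisson_bracket_on_magnetic[OF open_phase R smooth_curvature RP])
    fix z :: phase assume "z \<in> D \<times> UNIV"
    then obtain q P where z: "z = (q, P)" "q \<in> D"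
      by auto
    with assms(11) have "N q \<noteq> 0"
      by force
    with z show "dir_deriv R z (e\<^sub>q 1) = - R z * dir_deriv (\<lambda>z. S z) z (e\<^sub>P 2)"
      "dir_deriv R z (e\<^sub>q 2) = R z * dir_deriv (\<lambda>z. S z) z (e\<^sub>P 1)"
      \<comment> \<open>The quotient rule turns the two equations for the derivatives of
        \<open>N\<close> into those required of \<open>R\<close>.\<close>
      by (simp_all add: Rq N dir_deriv_curvature_momentum R_def power2_eq_square)
  qed
  \<comment> \<open>The four equations of motion: each coordinate bracketed with \<open>H\<close>
    and multiplied by \<open>N\<close> gives the corresponding component of the field.\<close>
  moreover have "dir_deriv (\<lambda>z. phase_coordinates z $ k) (q, P) (reduced_field a1 a2 (lagrangian g c U) (q, P)) =
      N q * B (\<lambda>z. phase_coordinates z $ k) H (q, P)" if "q \<in> D" for q P k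
  proof -
    have "N q \<noteq> 0"
      using assms(11)[OF that] by simp
    then show ?thesis
      unfolding B_def magnetic_bracket_def dir_deriv_phase_coordinates reduced_field_eq
      using exhaust_4[of k] by (auto simp: phase_coordinates_def R_def vector_4 axis_def)
  qed
  ultimately show ?thesis
    unfolding conformally_hamiltonian_on_def
    using smooth_hamiltonian assms(10,11) global_coordinates_phase[OF open_phase] by blast
qed

end
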